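(* A function $\varphi:\mathbb{N}\to\mathbb{N}$ is a functional closure property of $\#\mathsf{FA}$ if and only if $\varphi$ is an ultimately PORC function. Moreover, this equivalence still holds when $\#\mathsf{FA}$ is restricted to unary languages, i.e. $\varphi$ is ultimately PORC if and only if for every $f\in\#\mathsf{FA}$ over the one-letter alphabet $\{1\}$ the function $w\mapsto \varphi(f(w))$ belongs to $\#\mathsf{FA}$.
   Context: $\mathbb{N}=\{0,1,2,\dots\}$. An NFA is a tuple $M=(Q,\Sigma,\mathrm{wt},\mathrm{in},\mathrm{out})$ with $Q,\Sigma$ finite sets, $\mathrm{wt}:Q\times\Sigma\times Q\to\mathbb{N}$, $\mathrm{in},\mathrm{out}:Q\to\mathbb{N}$. A computation on $w=w_1\cdots w_n\in\Sigma^\star$ is any sequence $q_0q_1\cdots q_n\in Q^{n+1}$, with weight $\mathrm{in}(q_0)\prod_{i=1}^n\mathrm{wt}(q_{i-1},w_i,q_i)\,\mathrm{out}(q_n)$; $M$ computes $f:\Sigma^\star\to\mathbb{N}$ where $f(w)$ is the sum of weights of all computations on $w$. $\#\mathsf{FA}$ is the set of all functions $f:\Sigma^\star\to\mathbb{N}$ (for finite alphabets $\Sigma$) computed by some NFA. A function $\varphi:\mathbb{N}^m\to\mathbb{N}$ is a functional closure property of $\#\mathsf{FA}$ if for every finite alphabet $\Sigma$ and all $f_1,\dots,f_m\in\#\mathsf{FA}$ over $\Sigma$, the function $w\mapsto\varphi(f_1(w),\dots,f_m(w))$ is in $\#\mathsf{FA}$. For $n\in\mathbb{N}$ and $p\ge1$,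 $n \operatorname{rem} p\in\{0,\dots,p-1\}$ is the remainder of $n$ mod $p$. A function $\varphi:\mathbb{N}\to\mathbb{N}$ is ultimately PORC if there exist $p\in\mathbb{N}\setminus\{0\}$, $N\in\mathbb{N}$ and polynomials $\varphi_0,\dots,\varphi_{p-1}$ with rational coefficients such that $\varphi(n)=\varphi_{n\operatorname{rem}p}(n)$ for all $n\ge N$. *)

theory Defs
  imports "HOL-Computational_Algebra.Polynomial"
begin

text \<open>
  The weight functions are total HOL functions, but only their values on \<open>states\<close> and
  \<open>alphabet\<close> ever matter.
\<close>

record ('q, 'a) nfa =
  states :: "'q set"
  alphabet :: "'a set"
  wt :: "'q \<Rightarrow> 'a \<Rightarrow> 'q \<Rightarrow> nat"
  init :: "'q \<Rightarrow> nat"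
  out :: "'q \<Rightarrow> nat"

definition is_nfa :: "('q, 'a) nfa \<Rightarrow> bool" where
  "is_nfa M \<longleftrightarrow> finite (states M) \<and> finite (alphabet M)"

definition computations :: "('q, 'a) nfa \<Rightarrow> 'a list \<Rightarrow> 'q list set" where
  "computations M w = {qs. length qs = Suc (length w) \<and> set qs \<subseteq> states M}"

definition weight :: "('q, 'a) nfa \<Rightarrow> 'a list \<Rightarrow> 'q list \<Rightarrow> nat" where
  "weight M w qs =
     init M (qs ! 0) * (\<Prod>i<length w. wt M (qs ! i) (w ! i) (qs ! Suc i)) * out M (qs ! length w)"

definition nfa_value :: "('q, 'a) nfa \<Rightarrow> 'a list \<Rightarrow> nat" where
  "nfa_value M w = (\<Sum>qs\<in>computations M w. weight M w qs)"

text \<open>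
  A function on words over the alphabet \<open>\<Sigma>\<close> is represented by any total function on
  \<^typ>\<open>'a list\<close>; its values outside \<^term>\<open>lists \<Sigma>\<close> are irrelevant.
\<close>

definition computes :: "('q, 'a) nfa \<Rightarrow> ('a list \<Rightarrow> nat) \<Rightarrow> bool" where
  "computes M f \<longleftrightarrow> (\<forall>w\<in>lists (alphabet M). f w = nfa_value M w)"

text \<open>
  States are natural numbers here only because HOL cannot quantify existentially over types;
  lemma \<open>computes_in_sharp_FA\<close> shows that automata over an arbitrary type of states add
  nothing.
\<close>

definition sharp_FA :: "'a set \<Rightarrow> ('a list \<Rightarrow> nat) set" where
  "sharp_FA \<Sigma> = {f. \<exists>M :: (nat, 'a) nfa. is_nfa M \<and> alphabet M = \<Sigma> \<and> computes M f}"

text \<open>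
  The alphabet ranges over all finite sets of letters of the type \<open>'a\<close>, which HOL cannot
  quantify inside a definition and which is therefore an explicit parameter.
\<close>

definition functional_closure_property :: "'a itself \<Rightarrow> (nat \<Rightarrow> nat) \<Rightarrow> bool" where
  "functional_closure_property _ \<phi> \<longleftrightarrow>
     (\<forall>\<Sigma> :: 'a set. finite \<Sigma> \<longrightarrow> (\<forall>f\<in>sharp_FA \<Sigma>. (\<lambda>w. \<phi> (f w)) \<in> sharp_FA \<Sigma>))"

definition ultimately_PORC :: "(nat \<Rightarrow> nat) \<Rightarrow> bool" where
  "ultimately_PORC \<phi> \<longleftrightarrow>
     (\<exists>p N. \<exists>P :: nat \<Rightarrow> rat poly. p \<noteq> 0 \<and>
        (\<forall>n\<ge>N. of_nat (\<phi> n) = poly (P (n mod p)) (of_nat n)))"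

lemma computes_in_sharp_FA:
  fixes M :: "('q, 'a) nfa"
  assumes M: "is_nfa M" and f: "computes M f"
  shows "f \<in> sharp_FA (alphabet M)"
proof -
  have fin: "finite (states M)"
    using M by (simp add: is_nfa_def)
  obtain e :: "'q \<Rightarrow> nat" where e: "inj_on e (states M)"
    using finite_imp_inj_to_nat_seg[OF fin] by blast
  define d where "d = inv_into (states M) e"
  have d: "d (e q) = q" if "q \<in> states M" for q
    using e that by (simp add: d_def)
  define M' :: "(nat, 'a) nfa" where
    "M' = \<lparr>states = e ` states M, alphabet = alphabet M,
           wt = (\<lambda>q a r. wt M (d q) a (d r)), init = (\<lambda>q. init M (d q)),
           out = (\<lambda>q. out M (d q))\<rparr>"
  have val: "nfa_value M' w = nfa_value M w" for w
    unfolding nfa_value_def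
  proof (rule sum.reindex_bij_witness[where i = "map e" and j = "map d"])
    fix qs assume "qs \<in> computations M' w"
    then have len: "length qs = Suc (length w)" and sub: "set qs \<subseteq> e ` states M"
      by (auto simp: computations_def M'_def)
    have dq: "d q \<in> states M \<and> e (d q) = q" if "q \<in> set qs" for q
      using sub that d by auto
    show "map e (map d qs) = qs"
      using dq by (simp add: map_idI)
    show "map d qs \<in> computations M w"
      using len dq by (auto simp: computations_def)
    show "weight M w (map d qs) = weight M' w qs"
      using len by (simp add: weight_def M'_def)
  next
    fix qs assume qs: "qs \<in> computations M w"
    then show "map d (map e qs) = qs"
      using d by (auto simp: computations_def intro!: map_idI)
    show "map e qs \<in> computations M' w"
      using qs by (auto simp: computations_def M'_def)
  qed
  have "is_nfa M' \<and> alphabet M' = alphabet M \<and> computes M' f"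
    using M f val by (simp add: is_nfa_def computes_def M'_def)
  then show ?thesis
    unfolding sharp_FA_def by blast
qed

end

theory Submission
  imports Defs "HOL-Library.FuncSet"
begin

text \<open>
  An ultimately PORC function is, above a threshold \<open>N\<close> and on each residue class modulo
  \<open>p\<close>, a polynomial with nonnegative integer coefficients in the number of periods above
  \<open>N\<close>, divided by a constant; the coefficients become nonnegative once \<open>N\<close> is large.
  Since \<open>#FA\<close> is closed under sums and products, only the residue and the exact quotient
  remain. Both are read off a vector of path counts entry by entry: the residues of the entries
  have finitely many values and are tracked deterministically, while the quotients evolve by the
  original matrices plus a correction that depends on the residues alone.

  Conversely, a closure property \<open>\<phi>\<close> is itself computed by an automaton on unary words
  (apply it to the length). If an accessible and co-accessible state had two closed walks of the
  same length, \<open>\<phi>\<close> would grow exponentially along an arithmetic progression, and its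
  composition with \<open>n \<mapsto> a 2\<^sup>n + b\<close> doubly exponentially, which no automaton can
  do. Hence a suitable power of the transition matrix is triangular with diagonal entries 0 and 1
  on the relevant states, and its powers are eventually polynomial.
\<close>

section \<open>Automata as linear systems\<close>

text \<open>The total weight of the computations that start in \<open>q\<close>, without the initial
  weight. As \<open>w\<close> grows at its front, these values evolve linearly.\<close>

primrec run :: "('q, 'a) nfa \<Rightarrow> 'a list \<Rightarrow> 'q \<Rightarrow> nat" where
  "run M [] q = out M q"
| "run M (a # w) q = (\<Sum>r\<in>states M. wt M q a r * run M w r)"

definition paths :: "'q set \<Rightarrow> nat \<Rightarrow> 'q list set" where
  "paths Q n = {qs. length qs = n \<and> set qs \<subseteq> Q}"

lemma paths_0: "paths Q 0 = {[]}"
  by (auto simp: paths_def)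

lemma sum_paths_Suc: "(\<Sum>qs\<in>paths Q (Suc n). g qs) = (\<Sum>q\<in>Q. \<Sum>qs\<in>paths Q n. g (q # qs))"
proof -
  have "(\<Sum>qs\<in>paths Q (Suc n). g qs) = (\<Sum>(q, qs)\<in>Q \<times> paths Q n. g (q # qs))"
    by (rule sum.reindex_bij_witness[where i = "\<lambda>(q, qs). q # qs" and j = "\<lambda>qs. (hd qs, tl qs)"])
      (auto simp: paths_def length_Suc_conv)
  then show ?thesis
    by (simp add: sum.cartesian_product)
qed

lemma sum_paths_eq_run:
  "(\<Sum>qs\<in>paths (states M) (length w).
      (\<Prod>i<length w. wt M ((q # qs) ! i) (w ! i) (qs ! i)) * out M ((q # qs) ! length w))
   = run M w q"
proof (induction w arbitrary: q)
  case Nil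
  then show ?case by (simp add: paths_0)
next
  case (Cons a w)
  then show ?case
    by (simp add: sum_paths_Suc prod.lessThan_Suc_shift mult.assoc del: prod.lessThan_Suc
        flip: sum_distrib_left)
qed

lemma nfa_value_eq_run: "nfa_value M w = (\<Sum>q\<in>states M. init M q * run M w q)"
proof -
  have "computations M w = paths (states M) (Suc (length w))"
    by (simp add: computations_def paths_def)
  then show ?thesis
    by (simp add: nfa_value_def weight_def sum_paths_Suc mult.assoc sum_paths_eq_run
        flip: sum_distrib_left)
qed

text \<open>A criterion free of automata: finitely many functions on words for which prepending a
  letter acts linearly. Their values at the empty word become the output weights.\<close>

lemma sharp_FA_I:
  fixes x :: "'a list \<Rightarrow> 'q \<Rightarrow> nat"
  assumes fin: "finite Q" "finite \<Sigma>"
    and step: "\<And>a w q. a \<in> \<Sigma> \<Longrightarrow> w \<in> lists \<Sigma> \<Longrightarrow> q \<in> Q \<Longrightarrow> x (a # w) q = (\<Sum>r\<in>Q. A q a r * x w r)"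
    and f: "\<And>w. w \<in> lists \<Sigma> \<Longrightarrow> f w = (\<Sum>q\<in>Q. i q * x w q)"
  shows "f \<in> sharp_FA \<Sigma>"
proof -
  define M where "M = \<lparr>states = Q, alphabet = \<Sigma>, wt = A, init = i, out = x []\<rparr>"
  have run: "q \<in> Q \<Longrightarrow> run M w q = x w q" if "w \<in> lists \<Sigma>" for w q
    using that
  proof (induction w arbitrary: q rule: lists.induct)
    case Nil
    then show ?case by (simp add: M_def)
  next
    case (Cons a w)
    then show ?case using step by (simp add: M_def)
  qed
  have "is_nfa M" "alphabet M = \<Sigma>"
    using fin by (simp_all add: is_nfa_def M_def)
  moreover have "computes M f"
    using f run by (simp add: computes_def nfa_value_eq_run) (simp add: M_def)
  ultimately show ?thesis
    using computes_in_sharp_FA by metis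
qed

lemma sharp_FA_E:
  assumes "f \<in> sharp_FA \<Sigma>"
  obtains Q :: "nat set" and x A i where "finite Q" "finite \<Sigma>"
    "\<And>a w q. x (a # w) q = (\<Sum>r\<in>Q. A q a r * x w r)"
    "\<And>w. w \<in> lists \<Sigma> \<Longrightarrow> f w = (\<Sum>q\<in>Q. i q * x w q)"
proof -
  obtain M :: "(nat, 'a) nfa" where "is_nfa M" "alphabet M = \<Sigma>" "computes M f"
    using assms by (auto simp: sharp_FA_def)
  then show thesis
    by (intro that[of "states M" "run M" "wt M" "init M"])
      (simp_all add: is_nfa_def computes_def nfa_value_eq_run)
qed

section \<open>Closure properties\<close>

lemma sharp_FA_const:
  assumes "finite \<Sigma>"
  shows "(\<lambda>w. c) \<in> sharp_FA \<Sigma>"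
  by (rule sharp_FA_I[where Q = "{()}" and x = "\<lambda>_ _. 1" and A = "\<lambda>_ _ _. 1" and i = "\<lambda>_. c"]) (use assms in auto)

text \<open>The disjoint union of the two systems.\<close>

lemma sharp_FA_add:
  assumes "f \<in> sharp_FA \<Sigma>" "g \<in> sharp_FA \<Sigma>"
  shows "(\<lambda>w. f w + g w) \<in> sharp_FA \<Sigma>"
proof -
  obtain Q :: "nat set" and x A i where Q: "finite Q" "finite \<Sigma>"
    "\<And>a w q. x (a # w) q = (\<Sum>r\<in>Q. A q a r * x w r)"
    "\<And>w. w \<in> lists \<Sigma> \<Longrightarrow> f w = (\<Sum>q\<in>Q. i q * x w q)"
    by (rule sharp_FA_E[OF assms(1)]) (rule that)
  obtain R :: "nat set" and y B j where R: "finite R" "finite \<Sigma>"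
    "\<And>a w q. y (a # w) q = (\<Sum>r\<in>R. B q a r * y w r)"
    "\<And>w. w \<in> lists \<Sigma> \<Longrightarrow> g w = (\<Sum>q\<in>R. j q * y w q)"
    by (rule sharp_FA_E[OF assms(2)]) (rule that)
  show ?thesis
  proof (rule sharp_FA_I[where Q = "Q <+> R" and i = "case_sum i j" and x = "\<lambda>w. case_sum (x w) (y w)"
        and A = "\<lambda>q a r. case (q, r) of (Inl q, Inl r) \<Rightarrow> A q a r | (Inr q, Inr r) \<Rightarrow> B q a r | _ \<Rightarrow> 0"])
    fix a w q assume "q \<in> Q <+> R"
    then show "case_sum (x (a # w)) (y (a # w)) q = (\<Sum>r\<in>Q <+> R. (case (q, r) of
        (Inl q, Inl r) \<Rightarrow> A q a r | (Inr q, Inr r) \<Rightarrow> B q a r | _ \<Rightarrow> 0) * case_sum (x w) (y w) r)"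
      by (auto simp: sum.Plus Q(1) R(1) Q(3)[of a w] R(3)[of a w])
  next
    fix w assume "w \<in> lists \<Sigma>"
    then show "f w + g w = (\<Sum>q\<in>Q <+> R. case_sum i j q * case_sum (x w) (y w) q)"
      by (simp add: sum.Plus Q(1,4) R(1,4))
  qed (simp_all add: Q(1,2) R(1))
qed

text \<open>The product system: expanding a product of two sums gives a sum over pairs of
  states.\<close>

lemma sharp_FA_mult:
  assumes "f \<in> sharp_FA \<Sigma>" "g \<in> sharp_FA \<Sigma>"
  shows "(\<lambda>w. f w * g w) \<in> sharp_FA \<Sigma>"
proof -
  obtain Q :: "nat set" and x A i where Q: "finite Q" "finite \<Sigma>"
    "\<And>a w q. x (a # w) q = (\<Sum>r\<in>Q. A q a r * x w r)"
    "\<And>w. w \<in> lists \<Sigma> \<Longrightarrow> f w = (\<Sum>q\<in>Q. i q * x w q)"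
    by (rule sharp_FA_E[OF assms(1)]) (rule that)
  obtain R :: "nat set" and y B j where R: "finite R" "finite \<Sigma>"
    "\<And>a w q. y (a # w) q = (\<Sum>r\<in>R. B q a r * y w r)"
    "\<And>w. w \<in> lists \<Sigma> \<Longrightarrow> g w = (\<Sum>q\<in>R. j q * y w q)"
    by (rule sharp_FA_E[OF assms(2)]) (rule that)
  show ?thesis
  proof (rule sharp_FA_I[where Q = "Q \<times> R" and i = "\<lambda>(q, r). i q * j r"
        and x = "\<lambda>w (q, r). x w q * y w r" and A = "\<lambda>(q, q') a (r, r'). A q a r * B q' a r'"])
    fix a w q
    show "(case q of (q, r) \<Rightarrow> x (a # w) q * y (a # w) r) = (\<Sum>r\<in>Q \<times> R.
        (case q of (q, q') \<Rightarrow> \<lambda>a (r, r'). A q a r * B q' a r') a r * (case r of (q, r) \<Rightarrow> x w q * y w r))"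
      by (cases q) (simp add: sum_product sum.cartesian_product Q(3)[of a w] R(3)[of a w] ac_simps case_prod_unfold)
  next
    fix w assume "w \<in> lists \<Sigma>"
    then show "f w * g w = (\<Sum>q\<in>Q \<times> R. (case q of (q, r) \<Rightarrow> i q * j r) * (case q of (q, r) \<Rightarrow> x w q * y w r))"
      by (simp add: sum_product sum.cartesian_product Q(4) R(4) ac_simps case_prod_unfold)
  qed (simp_all add: Q(1,2) R(1))
qed

lemma sharp_FA_sum:
  assumes "finite \<Sigma>" "\<And>k. k \<in> K \<Longrightarrow> f k \<in> sharp_FA \<Sigma>"
  shows "(\<lambda>w. \<Sum>k\<in>K. f k w) \<in> sharp_FA \<Sigma>"
  using assms(2)
  by (induction K rule: infinite_finite_induct) (auto intro: sharp_FA_const sharp_FA_add assms(1))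

lemma sharp_FA_power:
  assumes "finite \<Sigma>" "f \<in> sharp_FA \<Sigma>"
  shows "(\<lambda>w. f w ^ k) \<in> sharp_FA \<Sigma>"
  by (induction k) (auto intro: sharp_FA_const[of _ 1, simplified] sharp_FA_mult assms)

text \<open>State \<open>True\<close> carries the constant 1 and state \<open>False\<close> the
  length; the transition from \<open>False\<close> to \<open>True\<close> adds 1 per letter.\<close>

lemma sharp_FA_length:
  assumes "finite \<Sigma>"
  shows "length \<in> sharp_FA \<Sigma>"
  by (rule sharp_FA_I[where Q = UNIV and x = "\<lambda>w b. if b then 1 else length w"
        and A = "\<lambda>q _ r. of_bool (q \<longrightarrow> r)" and i = "\<lambda>b. of_bool (\<not> b)"]) (use assms in \<open>auto simp: UNIV_bool\<close>)

lemma sharp_FA_power_length: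
  assumes "finite \<Sigma>"
  shows "(\<lambda>w. c ^ length w) \<in> sharp_FA \<Sigma>"
  by (rule sharp_FA_I[where Q = "{()}" and x = "\<lambda>w _. c ^ length w" and A = "\<lambda>_ _ _. c" and i = "\<lambda>_. 1"]) (use assms in auto)

text \<open>
  The component \<open>\<sigma>\<close> is computed by a co-deterministic automaton: reading a word from
  right to left, its state is determined.
\<close>

lemma sharp_FA_affine:
  fixes y :: "'a list \<Rightarrow> 'q \<Rightarrow> nat" and \<sigma> :: "'a list \<Rightarrow> 's"
  assumes fin: "finite Q" "finite \<Sigma>" "finite S"
    and \<sigma>: "\<And>w. w \<in> lists \<Sigma> \<Longrightarrow> \<sigma> w \<in> S"
      "\<And>a w. a \<in> \<Sigma> \<Longrightarrow> w \<in> lists \<Sigma> \<Longrightarrow> \<sigma> (a # w) = \<delta> a (\<sigma> w)"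
    and y: "\<And>a w q. a \<in> \<Sigma> \<Longrightarrow> w \<in> lists \<Sigma> \<Longrightarrow> q \<in> Q \<Longrightarrow>
        y (a # w) q = (\<Sum>r\<in>Q. A q a r * y w r) + \<kappa> q a (\<sigma> w)"
    and f: "\<And>w. w \<in> lists \<Sigma> \<Longrightarrow> f w = (\<Sum>q\<in>Q. i q * y w q) + g (\<sigma> w)"
  shows "f \<in> sharp_FA \<Sigma>"
proof (rule sharp_FA_I[where Q = "Q <+> S" and i = "case_sum i g"
      and x = "\<lambda>w. case_sum (y w) (\<lambda>s. of_bool (s = \<sigma> w))"
      and A = "\<lambda>q a r. case (q, r) of (Inl q, Inl r) \<Rightarrow> A q a r | (Inl q, Inr s) \<Rightarrow> \<kappa> q a s
        | (Inr s, Inr t) \<Rightarrow> of_bool (s = \<delta> a t) | _ \<Rightarrow> 0"])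
  \<comment> \<open>Exactly one indicator on \<open>S\<close> is 1, the one at
    \<open>\<sigma> w\<close>, so an edge from \<open>q\<close> to \<open>s\<close> of weight
    \<open>\<kappa> q a s\<close> contributes precisely the correction term.\<close>
  have delta: "(\<Sum>s\<in>S. h s * of_bool (s = \<sigma> w)) = h (\<sigma> w)" if "w \<in> lists \<Sigma>" for h :: "'s \<Rightarrow> nat" and w
    using fin(3) \<sigma>(1)[OF that]
    by (simp add: of_bool_def if_distrib[of "\<lambda>k. _ * k"] cong: if_cong)
  show "case_sum (y (a # w)) (\<lambda>s. of_bool (s = \<sigma> (a # w))) q =
      (\<Sum>r\<in>Q <+> S. (case (q, r) of (Inl q, Inl r) \<Rightarrow> A q a r | (Inl q, Inr s) \<Rightarrow> \<kappa> q a s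
        | (Inr s, Inr t) \<Rightarrow> of_bool (s = \<delta> a t) | _ \<Rightarrow> 0) *
        case_sum (y w) (\<lambda>s. of_bool (s = \<sigma> w)) r)"
    if "a \<in> \<Sigma>" "w \<in> lists \<Sigma>" "q \<in> Q <+> S" for a w q
    using that(3) fin y[OF that(1,2)] \<sigma>(2)[OF that(1,2)]
    by (auto simp: sum.Plus delta[OF that(2)])
  show "f w = (\<Sum>q\<in>Q <+> S. case_sum i g q * case_sum (y w) (\<lambda>s. of_bool (s = \<sigma> w)) q)"
    if "w \<in> lists \<Sigma>" for w
    using fin f[OF that] by (simp add: sum.Plus delta[OF that])
qed (use fin in auto)

text \<open>
  The normal form of a natural number in the quotient semiring of the naturals with threshold
  \<open>N\<close> and period \<open>p\<close>, and the number of periods removed to reach it.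
\<close>

definition res :: "nat \<Rightarrow> nat \<Rightarrow> nat \<Rightarrow> nat" where
  "res N p n = (if n < N then n else N + (n - N) mod p)"

definition quo :: "nat \<Rightarrow> nat \<Rightarrow> nat \<Rightarrow> nat" where
  "quo N p n = (n - N) div p"

lemma res_quo: "res N p n + p * quo N p n = n"
  by (auto simp: res_def quo_def)

lemma res_less: "p > 0 \<Longrightarrow> res N p n < N + p"
  by (simp add: res_def)

text \<open>Only numbers that have reached the threshold absorb periods; below it the residue is the
  number itself.\<close>

lemma res_quo_add_mult:
  assumes "p > 0" "N \<le> n \<or> k = 0"
  shows "res N p (n + p * k) = res N p n" "quo N p (n + p * k) = quo N p n + k"
proof -
  have "res N p (n + p * k) = res N p n \<and> quo N p (n + p * k) = quo N p n + k"
  proof (cases "N \<le> n")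
    case True
    then obtain m where "n = N + m"
      using le_Suc_ex by blast
    with assms(1) show ?thesis
      by (simp add: res_def quo_def)
  qed (use assms in simp)
  then show "res N p (n + p * k) = res N p n" "quo N p (n + p * k) = quo N p n + k"
    by simp_all
qed

text \<open>Residues of linear combinations depend on residues alone, and quotients are linear up to
  a correction that depends on residues alone.\<close>

lemma res_quo_sum:
  fixes Q :: "'q set"
  assumes "finite Q" "p > 0"
  shows "res N p (\<Sum>q\<in>Q. c q * x q) = res N p (\<Sum>q\<in>Q. c q * res N p (x q))"
    and "quo N p (\<Sum>q\<in>Q. c q * x q) =
      (\<Sum>q\<in>Q. c q * quo N p (x q)) + quo N p (\<Sum>q\<in>Q. c q * res N p (x q))"
proof -
  define n where "n = (\<Sum>q\<in>Q. c q * res N p (x q))"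
  define k where "k = (\<Sum>q\<in>Q. c q * quo N p (x q))"
  have "(\<Sum>q\<in>Q. c q * x q) = (\<Sum>q\<in>Q. c q * (res N p (x q) + p * quo N p (x q)))"
    by (simp add: res_quo)
  also have "\<dots> = n + p * k"
    by (simp add: n_def k_def algebra_simps sum.distrib sum_distrib_left)
  finally have sum: "(\<Sum>q\<in>Q. c q * x q) = n + p * k" .
  \<comment> \<open>If some summand contributes a period, its \<open>x q\<close> has reached the
    threshold and its coefficient is positive, so its reduced term alone is at least
    \<open>N\<close>.\<close>
  have "N \<le> n \<or> k = 0"
  proof (cases "k = 0")
    case False
    then obtain q where q: "q \<in> Q" "c q * quo N p (x q) \<noteq> 0"
      unfolding k_def by (meson sum.neutral)
    then have "N \<le> res N p (x q)"
      by (auto simp: res_def quo_def)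
    also have "\<dots> \<le> c q * res N p (x q)"
      using q by simp
    also have "\<dots> \<le> n"
      unfolding n_def using q assms by (intro member_le_sum) auto
    finally show ?thesis ..
  qed simp
  from res_quo_add_mult[OF assms(2) this]
  show "res N p (\<Sum>q\<in>Q. c q * x q) = res N p (\<Sum>q\<in>Q. c q * res N p (x q))"
    and "quo N p (\<Sum>q\<in>Q. c q * x q) =
      (\<Sum>q\<in>Q. c q * quo N p (x q)) + quo N p (\<Sum>q\<in>Q. c q * res N p (x q))"
    unfolding sum by (simp_all add: n_def k_def)
qed

text \<open>The vector of residues is the deterministic part and the quotients are the affine part.
  Restricting vectors to \<open>Q\<close> makes them range over a finite set.\<close>

lemma sharp_FA_quo_res:
  assumes f: "f \<in> sharp_FA \<Sigma>" and p: "p > 0"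
  shows "(\<lambda>w. b * quo N p (f w) + g (res N p (f w))) \<in> sharp_FA \<Sigma>"
proof -
  obtain Q :: "nat set" and x A i where Q: "finite Q" "finite \<Sigma>"
    "\<And>a w q. x (a # w) q = (\<Sum>r\<in>Q. A q a r * x w r)"
    "\<And>w. w \<in> lists \<Sigma> \<Longrightarrow> f w = (\<Sum>q\<in>Q. i q * x w q)"
    by (rule sharp_FA_E[OF f]) (rule that)
  note rq = res_quo_sum[OF Q(1) p]
  show ?thesis
  proof (rule sharp_FA_affine[where Q = Q and S = "Q \<rightarrow>\<^sub>E {..<N + p}" and A = A
        and \<sigma> = "\<lambda>w. \<lambda>q\<in>Q. res N p (x w q)"
        and \<delta> = "\<lambda>a s. \<lambda>q\<in>Q. res N p (\<Sum>r\<in>Q. A q a r * s r)"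
        and y = "\<lambda>w q. quo N p (x w q)"
        and \<kappa> = "\<lambda>q a s. quo N p (\<Sum>r\<in>Q. A q a r * s r)"
        and i = "\<lambda>q. b * i q"
        and g = "\<lambda>s. b * quo N p (\<Sum>q\<in>Q. i q * s q) + g (res N p (\<Sum>q\<in>Q. i q * s q))"])
    show "finite (Q \<rightarrow>\<^sub>E {..<N + p})"
      using Q by (simp add: finite_PiE)
    show "(\<lambda>q\<in>Q. res N p (x w q)) \<in> Q \<rightarrow>\<^sub>E {..<N + p}" for w
      using p by (auto simp: res_less)
  next
    fix a w
    show "(\<lambda>q\<in>Q. res N p (x (a # w) q)) =
        (\<lambda>q\<in>Q. res N p (\<Sum>r\<in>Q. A q a r * (\<lambda>q\<in>Q. res N p (x w q)) r))"
      by (intro restrict_ext) (simp add: Q(3)[of a w] rq(1)[where x = "x w"])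
    show "quo N p (x (a # w) q) = (\<Sum>r\<in>Q. A q a r * quo N p (x w r)) +
        quo N p (\<Sum>r\<in>Q. A q a r * (\<lambda>q\<in>Q. res N p (x w q)) r)" for q
      by (simp add: Q(3)[of a w] rq(2)[where c = "A q a" and x = "x w"])
  next
    fix w assume "w \<in> lists \<Sigma>"
    then show "b * quo N p (f w) + g (res N p (f w)) = (\<Sum>q\<in>Q. b * i q * quo N p (x w q)) +
        (b * quo N p (\<Sum>q\<in>Q. i q * (\<lambda>q\<in>Q. res N p (x w q)) q) +
         g (res N p (\<Sum>q\<in>Q. i q * (\<lambda>q\<in>Q. res N p (x w q)) q)))"
      by (simp add: Q(4) rq[where c = i and x = "x w"] distrib_left mult.assoc flip: sum_distrib_left)
  qed (simp_all add: Q(1,2))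
qed

section \<open>Ultimately PORC functions are closure properties\<close>

text \<open>Induction along the coefficients. The lower bound on \<open>poly Q k\<close> strengthens
  the claim: the new constant coefficient is \<open>a + k * poly P k\<close>, which needs growth of
  \<open>P\<close>.\<close>

lemma nonneg_coeffs_pcompose_shift:
  fixes Q :: "'b :: linordered_field poly"
  assumes "lead_coeff Q > 0"
  shows "\<exists>K. \<forall>k\<ge>K. (\<forall>i. coeff (pcompose Q [:k, 1:]) i \<ge> 0) \<and> poly Q k \<ge> lead_coeff Q"
  using assms
proof (induction Q)
  case (pCons a P)
  show ?case
  proof (cases "P = 0")
    case True
    with pCons.prems show ?thesis
      by (auto simp: pcompose_pCons coeff_pCons split: nat.splits)
  next
    case False
    define l where "l = lead_coeff P"
    have l: "l > 0"
      using pCons.prems False by (simp add: l_def)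
    then obtain K where K: "\<And>k i. k \<ge> K \<Longrightarrow> coeff (pcompose P [:k, 1:]) i \<ge> 0"
      "\<And>k. k \<ge> K \<Longrightarrow> poly P k \<ge> l"
      using pCons.IH unfolding l_def by blast
    have "(\<forall>i. coeff (pcompose (pCons a P) [:k, 1:]) i \<ge> 0) \<and>
        poly (pCons a P) k \<ge> lead_coeff (pCons a P)"
      \<comment> \<open>This bound yields \<open>k * l \<ge> \<bar>a\<bar> + l\<close>, enough to
        outweigh a negative \<open>a\<close>.\<close>
      if "k \<ge> max K (\<bar>a\<bar> / l + 1)" for k
    proof -
      have k: "k \<ge> K" "k \<ge> \<bar>a\<bar> / l + 1" "k \<ge> 0"
        using that l by (auto intro: order.trans[of 0 "\<bar>a\<bar> / l + 1"] add_nonneg_nonneg)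
      have "\<bar>a\<bar> + l = (\<bar>a\<bar> / l + 1) * l"
        using l by (simp add: field_simps)
      also have "\<dots> \<le> k * poly P k"
        using k l K(2)[OF k(1)] by (intro mult_mono) auto
      finally have val: "a + k * poly P k \<ge> l"
        by linarith
      have "coeff (pcompose (pCons a P) [:k, 1:]) i \<ge> 0" for i
      proof (cases i)
        case 0
        have "coeff (pcompose (pCons a P) [:k, 1:]) 0 = a + k * poly P k"
          by (simp flip: poly_0_coeff_0 add: poly_pcompose)
        with val l 0 show ?thesis by simp
      next
        case (Suc j)
        then show ?thesis
          using K(1)[OF k(1)] k(3) by (simp add: pcompose_pCons coeff_pCons)
      qed
      with val False show ?thesis by (simp add: l_def)
    qed
    then show ?thesis by blast
  qed
qed simp

text \<open>A negative leading coefficient would make \<open>- Q\<close> eventually positive, so a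
  nonzero \<open>Q\<close> has a positive one.\<close>

lemma nonneg_coeffs_pcompose_shift_of_frequently_nonneg:
  fixes Q :: "rat poly"
  assumes "\<And>K :: nat. \<exists>n\<ge>K. poly Q (of_nat n) \<ge> 0"
  shows "\<exists>K :: nat. \<forall>k\<ge>K. \<forall>i. coeff (pcompose Q [:of_nat k, 1:]) i \<ge> 0"
proof (cases "Q = 0")
  case False
  have "lead_coeff Q > 0"
  proof (rule ccontr)
    assume "\<not> lead_coeff Q > 0"
    with False have neg: "lead_coeff (- Q) > 0"
      by (metis leading_coeff_0_iff linorder_neqE neg_0_less_iff_less lead_coeff_minus)
    then obtain K where K: "\<And>k. k \<ge> K \<Longrightarrow> poly (- Q) k \<ge> lead_coeff (- Q)"
      using nonneg_coeffs_pcompose_shift by blast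
    obtain m :: nat where m: "K \<le> of_nat m"
      using real_arch_simple by blast
    obtain n where "n \<ge> m" "poly Q (of_nat n) \<ge> 0"
      using assms by blast
    then show False
      using K[of "of_nat n"] m neg by (simp add: order.trans[of _ "of_nat m"])
  qed
  then obtain K where K: "\<forall>k\<ge>K. \<forall>i. coeff (pcompose Q [:k, 1:]) i \<ge> 0"
    using nonneg_coeffs_pcompose_shift by blast
  obtain m :: nat where "K \<le> of_nat m"
    using real_arch_simple by blast
  with K have "\<forall>k\<ge>m. \<forall>i. coeff (pcompose Q [:of_nat k, 1:]) i \<ge> 0"
    by (meson of_nat_mono order.trans)
  then show ?thesis by blast
qed simp

lemma common_denominator_nat:
  fixes Q :: "rat poly"
  assumes "\<And>i. coeff Q i \<ge> 0"
  shows "\<exists>D c. D > 0 \<and> (\<forall>m. of_nat D * poly Q (of_nat m) = of_nat (\<Sum>i\<le>degree Q. c i * m ^ i))"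
proof -
  have "\<exists>d n :: nat. d > 0 \<and> of_nat d * coeff Q i = of_nat n" for i
  proof -
    obtain a b where ab: "quotient_of (coeff Q i) = (a, b)" "b > 0" "coeff Q i = of_int a / of_int b"
      using quotient_of_denom_pos quotient_of_div by (metis surj_pair)
    with assms[of i] have "a \<ge> 0"
      by (simp add: zero_le_divide_iff)
    with ab show ?thesis
      by (intro exI[of _ "nat b"] exI[of _ "nat a"]) simp
  qed
  then obtain d n :: "nat \<Rightarrow> nat" where dn: "\<And>i. d i > 0" "\<And>i. of_nat (d i) * coeff Q i = of_nat (n i)"
    by metis
  define D where "D = (\<Prod>i\<le>degree Q. d i)"
  \<comment> \<open>The numerator times all other denominators.\<close>
  define c where "c i = (\<Prod>j\<in>{..degree Q} - {i}. d j) * n i" for i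
  have c: "of_nat D * coeff Q i = of_nat (c i)" if "i \<le> degree Q" for i
  proof -
    have "D = (\<Prod>j\<in>{..degree Q} - {i}. d j) * d i"
      unfolding D_def using that by (simp add: prod.remove[of _ i] mult.commute)
    then show ?thesis
      by (simp add: c_def mult.assoc dn(2))
  qed
  have "of_nat D * poly Q (of_nat m) = of_nat (\<Sum>i\<le>degree Q. c i * m ^ i)" for m
    using c by (simp add: poly_altdef sum_distrib_left flip: mult.assoc)
  moreover have "D > 0"
    using dn(1) by (simp add: D_def prod_pos)
  ultimately show ?thesis by blast
qed

text \<open>Substituting \<open>r + p * m\<close> gives a polynomial in \<open>m\<close> with
  nonnegative coefficients once \<open>r\<close> is large. The division is exact, so it can be taken
  in the naturals.\<close>

lemma ultimately_PORC_normal_form: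
  assumes "ultimately_PORC \<phi>"
  shows "\<exists>N p D c d. p > 0 \<and> (\<forall>r. D r > 0) \<and>
    (\<forall>r\<ge>N. \<forall>m. \<phi> (r + p * m) = (\<Sum>i\<le>d r. c r i * m ^ i) div D r)"
proof -
  obtain p N and P :: "nat \<Rightarrow> rat poly" where p: "p > 0"
    and P: "\<And>n. n \<ge> N \<Longrightarrow> of_nat (\<phi> n) = poly (P (n mod p)) (of_nat n)"
    using assms by (auto simp: ultimately_PORC_def)
  have "\<exists>K :: nat. \<forall>k\<ge>K. \<forall>i. coeff (pcompose (P s) [:of_nat k, 1:]) i \<ge> 0" if "s < p" for s
  proof (rule nonneg_coeffs_pcompose_shift_of_frequently_nonneg)
    fix K
    define n where "n = s + p * (K + N)"
    have "K + N \<le> n"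
      unfolding n_def using p by (intro trans_le_add2) simp
    then have n: "K \<le> n" "N \<le> n"
      by simp_all
    have "n mod p = s"
      using that by (simp add: n_def)
    with n P[of n] show "\<exists>n\<ge>K. poly (P s) (of_nat n) \<ge> 0"
      by (metis of_nat_0_le_iff)
  qed
  then obtain K :: "nat \<Rightarrow> nat" where
    K: "\<And>s k i. s < p \<Longrightarrow> k \<ge> K s \<Longrightarrow> coeff (pcompose (P s) [:of_nat k, 1:]) i \<ge> 0"
    by metis
  define N' where "N' = N + (\<Sum>s<p. K s)"
  have N': "N' \<ge> K s" if "s < p" for s
    unfolding N'_def using that member_le_sum[of s "{..<p}" K] by simp
  define S where "S r = pcompose (pcompose (P (r mod p)) [:of_nat r, 1:]) [:0, of_nat p:]" for r
  have S: "poly (S r) (of_nat m) = of_nat (\<phi> (r + p * m))" if "r \<ge> N'" for r m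
    using P[of "r + p * m"] that by (simp add: S_def poly_pcompose N'_def mult.commute)
  \<comment> \<open>The guard on \<open>r\<close> stands inside, so that \<open>D\<close> can be
    chosen positive for every \<open>r\<close>.\<close>
  have "\<exists>D c. D > 0 \<and> (\<forall>m. r \<ge> N' \<longrightarrow> of_nat D * poly (S r) (of_nat m)
      = (of_nat (\<Sum>i\<le>degree (S r). c i * m ^ i) :: rat))" for r
  proof (cases "r \<ge> N'")
    case True
    have "coeff (S r) i \<ge> 0" for i
      using K[of "r mod p" r i] N'[of "r mod p"] True p
      by (simp add: S_def coeff_pcompose_linear)
    then show ?thesis
      using common_denominator_nat[of "S r"] by metis
  qed auto
  then obtain D c where D: "\<And>r. D r > 0"
    and c: "\<And>r m. r \<ge> N' \<Longrightarrow> of_nat (D r) * poly (S r) (of_nat m)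
      = (of_nat (\<Sum>i\<le>degree (S r). c r i * m ^ i) :: rat)"
    by metis
  have "\<phi> (r + p * m) = (\<Sum>i\<le>degree (S r). c r i * m ^ i) div D r" if "r \<ge> N'" for r m
  proof -
    have "of_nat (D r * \<phi> (r + p * m)) = (of_nat (\<Sum>i\<le>degree (S r). c r i * m ^ i) :: rat)"
      using c[OF that, of m] S[OF that, of m] by simp
    then have "D r * \<phi> (r + p * m) = (\<Sum>i\<le>degree (S r). c r i * m ^ i)"
      using of_nat_eq_iff by blast
    then show ?thesis
      using D[of r] by (metis less_not_refl nonzero_mult_div_cancel_left)
  qed
  with p D show ?thesis
    by (intro exI[of _ N'] exI[of _ p] exI[of _ D] exI[of _ c] exI[of _ "\<lambda>r. degree (S r)"]) blast
qed

lemma sharp_FA_ultimately_PORC: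
  assumes \<phi>: "ultimately_PORC \<phi>" and fin: "finite \<Sigma>" and f: "f \<in> sharp_FA \<Sigma>"
  shows "(\<lambda>w. \<phi> (f w)) \<in> sharp_FA \<Sigma>"
proof -
  obtain N p :: nat and D :: "nat \<Rightarrow> nat" and c d where p: "p > 0" and D: "\<And>r. D r > 0"
    and \<phi>_eq: "\<And>r m. N \<le> r \<Longrightarrow> \<phi> (r + p * m) = (\<Sum>i\<le>d r. c r i * m ^ i) div D r"
    using ultimately_PORC_normal_form[OF \<phi>] by metis
  have res: "(\<lambda>w. g (res N p (f w))) \<in> sharp_FA \<Sigma>" for g
    using sharp_FA_quo_res[OF f p, of 0] by simp
  have quo: "(\<lambda>w. quo N p (f w)) \<in> sharp_FA \<Sigma>"
    using sharp_FA_quo_res[OF f p, of 1 N "\<lambda>_. 0"] by simp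
  \<comment> \<open>With threshold 0 and period \<open>k\<close> the quotient is division by
    \<open>k\<close>.\<close>
  have div: "(\<lambda>w. g w div k) \<in> sharp_FA \<Sigma>" if "g \<in> sharp_FA \<Sigma>" "k > 0" for g and k :: nat
    using sharp_FA_quo_res[OF that, of 1 0 "\<lambda>_. 0"] by (simp add: quo_def)
  define F where "F r w = of_bool (res N p (f w) = r) *
      ((\<Sum>i\<le>d r. c r i * quo N p (f w) ^ i) div D r)" for r w
  have F: "F r \<in> sharp_FA \<Sigma>" for r
    unfolding F_def
    by (intro sharp_FA_mult res[of "\<lambda>k. of_bool (k = r)"] div sharp_FA_sum sharp_FA_const
        sharp_FA_power quo fin D)
  \<comment> \<open>Below \<open>N\<close> the residue is \<open>n\<close> itself; otherwise exactly
    one summand survives, and there \<open>m\<close> is the quotient.\<close>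
  have "\<phi> n = of_bool (res N p n < N) * \<phi> (res N p n) + (\<Sum>r\<in>{N..<N + p}. of_bool (res N p n = r) *
      ((\<Sum>i\<le>d r. c r i * quo N p n ^ i) div D r))" for n
  proof (cases "n < N")
    case True
    then show ?thesis
      by (simp add: res_def)
  next
    case False
    then have "res N p n \<in> {N..<N + p}"
      using p by (simp add: res_def)
    then show ?thesis
      using \<phi>_eq[of "res N p n" "quo N p n"]
      by (simp add: res_quo of_bool_def if_distrib[of "\<lambda>k. k * _"] sum.delta' cong: if_cong)
  qed
  then have eq: "(\<lambda>w. \<phi> (f w)) =
      (\<lambda>w. of_bool (res N p (f w) < N) * \<phi> (res N p (f w)) + (\<Sum>r\<in>{N..<N + p}. F r w))"
    unfolding F_def by blast
  show ?thesis
    unfolding eq by (intro sharp_FA_add sharp_FA_sum F fin res[of "\<lambda>k. of_bool (k < N) * \<phi> k"])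
qed

section \<open>Eventually polynomial sequences\<close>

definition eventually_poly :: "(nat \<Rightarrow> nat) \<Rightarrow> bool" where
  "eventually_poly f \<longleftrightarrow> (\<exists>(P :: rat poly) N. \<forall>k\<ge>N. of_nat (f k) = poly P (of_nat k))"

lemma eventually_poly_const: "eventually_poly (\<lambda>k. c)"
  unfolding eventually_poly_def by (intro exI[of _ "[:of_nat c:]"]) simp

lemma eventually_poly_add:
  assumes "eventually_poly f" "eventually_poly g"
  shows "eventually_poly (\<lambda>k. f k + g k)"
proof -
  obtain P Q :: "rat poly" and M N where
    "\<And>k. k \<ge> M \<Longrightarrow> of_nat (f k) = poly P (of_nat k)"
    "\<And>k. k \<ge> N \<Longrightarrow> of_nat (g k) = poly Q (of_nat k)"
    using assms unfolding eventually_poly_def by metis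
  then show ?thesis
    unfolding eventually_poly_def by (intro exI[of _ "P + Q"] exI[of _ "max M N"]) simp
qed

lemma eventually_poly_cmult:
  assumes "eventually_poly f"
  shows "eventually_poly (\<lambda>k. c * f k)"
proof -
  obtain P :: "rat poly" and N where "\<And>k. k \<ge> N \<Longrightarrow> of_nat (f k) = poly P (of_nat k)"
    using assms unfolding eventually_poly_def by metis
  then show ?thesis
    unfolding eventually_poly_def by (intro exI[of _ "smult (of_nat c) P"] exI[of _ N]) simp
qed

lemma eventually_poly_sum:
  assumes "\<And>a. a \<in> A \<Longrightarrow> eventually_poly (f a)"
  shows "eventually_poly (\<lambda>k. \<Sum>a\<in>A. f a k)"
  using assms
  by (induction A rule: infinite_finite_induct) (simp_all add: eventually_poly_const eventually_poly_add)

lemma eventually_poly_Suc_iff: "eventually_poly (\<lambda>k. f (Suc k)) \<longleftrightarrow> eventually_poly f"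
proof
  assume "eventually_poly (\<lambda>k. f (Suc k))"
  then obtain P :: "rat poly" and N where P: "\<And>k. k \<ge> N \<Longrightarrow> of_nat (f (Suc k)) = poly P (of_nat k)"
    unfolding eventually_poly_def by metis
  have "of_nat (f k) = poly (pcompose P [:-1, 1:]) (of_nat k)" if "k \<ge> Suc N" for k
    using P[of "k - 1"] that by (simp add: poly_pcompose of_nat_diff)
  then show "eventually_poly f"
    unfolding eventually_poly_def by blast
next
  assume "eventually_poly f"
  then obtain P :: "rat poly" and N where P: "\<And>k. k \<ge> N \<Longrightarrow> of_nat (f k) = poly P (of_nat k)"
    unfolding eventually_poly_def by metis
  have "of_nat (f (Suc k)) = poly (pcompose P [:1, 1:]) (of_nat k)" if "k \<ge> N" for k
    using P[of "Suc k"] that by (simp add: poly_pcompose)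
  then show "eventually_poly (\<lambda>k. f (Suc k))"
    unfolding eventually_poly_def by blast
qed

text \<open>Induction on the degree \<open>n\<close>: the difference \<open>T\<close> of a multiple
  of the monomial of degree \<open>n + 1\<close> cancels the leading term of
  \<open>P\<close>.\<close>

lemma poly_antidifference:
  fixes P :: "'b :: field_char_0 poly"
  shows "\<exists>R. \<forall>x. poly R (x + 1) - poly R x = poly P x"
proof (induction "degree P" arbitrary: P rule: less_induct)
  case less
  define n where "n = degree P"
  define c where "c = coeff P n / of_nat (Suc n)"
  define T where "T = smult c ([:1, 1:] ^ Suc n - [:0, 1:] ^ Suc n)"
  have coeff_T: "coeff T i = c * (of_nat (Suc n choose i) - (if i = Suc n then 1 else 0))" for i
  proof -
    have "coeff ([:1, 1 :: 'b:] ^ Suc n) i = of_nat (Suc n choose i)"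
      by (cases "i \<le> Suc n") (simp_all add: coeff_linear_poly_power binomial_eq_0 coeff_eq_0 degree_linear_power del: power_Suc)
    moreover have "coeff ([:0, 1 :: 'b:] ^ Suc n) i = (if i = Suc n then 1 else 0)"
      by (simp flip: monom_altdef[of 1, simplified] add: del: power_Suc)
    ultimately show ?thesis
      by (simp add: T_def del: power_Suc)
  qed
  have zero: "coeff (P - T) i = 0" if "i \<ge> n" for i
  proof -
    consider "i = n" | "i = Suc n" | "i > Suc n"
      using \<open>i \<ge> n\<close> by linarith
    then show ?thesis
    proof cases
      case 1
      then show ?thesis
        by (simp add: coeff_T c_def n_def del: of_nat_Suc)
    next
      case 2
      then show ?thesis
        by (simp add: coeff_T n_def coeff_eq_0)
    next
      case 3
      then show ?thesis
        by (simp add: coeff_T n_def coeff_eq_0 binomial_eq_0)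
    qed
  qed
  have T: "poly T x = poly (smult c ([:0, 1:] ^ Suc n)) (x + 1) - poly (smult c ([:0, 1:] ^ Suc n)) x" for x
    by (simp add: T_def algebra_simps)
  show ?case
  proof (cases "P - T = 0")
    case True
    then have "P = T" by simp
    with T show ?thesis by metis
  next
    case False
    then have "degree (P - T) < degree P"
      using zero by (metis leading_coeff_0_iff linorder_not_le n_def)
    then obtain R where R: "\<And>x. poly R (x + 1) - poly R x = poly (P - T) x"
      using less by blast
    define S where "S = smult c ([:0, 1:] ^ Suc n)"
    have "poly (R + S) (x + 1) - poly (R + S) x = poly P x" for x
    proof -
      have "poly (R + S) (x + 1) - poly (R + S) x
          = (poly R (x + 1) - poly R x) + (poly S (x + 1) - poly S x)"
        by simp
      also have "\<dots> = poly (P - T) x + poly T x"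
        unfolding R T S_def ..
      finally show ?thesis by simp
    qed
    then show ?thesis by blast
  qed
qed

lemma eventually_poly_of_difference:
  assumes "\<And>k. f (Suc k) = f k + g k" and "eventually_poly g"
  shows "eventually_poly f"
proof -
  obtain P :: "rat poly" and N where P: "\<And>k. k \<ge> N \<Longrightarrow> of_nat (g k) = poly P (of_nat k)"
    using assms(2) unfolding eventually_poly_def by metis
  obtain R where R: "\<And>x. poly R (x + 1) - poly R x = poly P x"
    using poly_antidifference[of P] by blast
  \<comment> \<open>The constant is adjusted to match \<open>f\<close> at \<open>N\<close>.\<close>
  define S where "S = R + [:of_nat (f N) - poly R (of_nat N):]"
  have "of_nat (f k) = poly S (of_nat k)" if "k \<ge> N" for k
    using that
  proof (induction k rule: dec_induct)
    case base
    show ?case by (simp add: S_def)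
  next
    case (step k)
    then show ?case
      using P[of k] R[of "of_nat k"] by (simp add: S_def assms(1) algebra_simps)
  qed
  then show ?thesis
    unfolding eventually_poly_def by blast
qed

section \<open>Linear recurrences of subexponential growth\<close>

text \<open>Entries of the powers of the matrix \<open>A\<close> on \<open>Q\<close>: the weighted
  number of walks of length \<open>n\<close> from \<open>q\<close> to \<open>r\<close>.\<close>

primrec mpow :: "'q set \<Rightarrow> ('q \<Rightarrow> 'q \<Rightarrow> nat) \<Rightarrow> nat \<Rightarrow> 'q \<Rightarrow> 'q \<Rightarrow> nat" where
  "mpow Q A 0 q r = of_bool (q = r)"
| "mpow Q A (Suc n) q r = (\<Sum>s\<in>Q. A q s * mpow Q A n s r)"

locale linear_recurrence =
  fixes Q :: "'q set" and A :: "'q \<Rightarrow> 'q \<Rightarrow> nat" and x :: "nat \<Rightarrow> 'q \<Rightarrow> nat"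
  assumes finite_Q: "finite Q"
    and x_Suc: "x (Suc n) q = (\<Sum>r\<in>Q. A q r * x n r)"
begin

abbreviation W where "W \<equiv> mpow Q A"

lemma W_add: "q \<in> Q \<Longrightarrow> W (m + n) q t = (\<Sum>r\<in>Q. W m q r * W n r t)"
proof (induction m arbitrary: q)
  case 0
  then show ?case
    using finite_Q by (simp add: of_bool_def if_distrib[of "\<lambda>k. k * _"] cong: if_cong)
next
  case (Suc m)
  have "W (Suc m + n) q t = (\<Sum>s\<in>Q. \<Sum>r\<in>Q. A q s * (W m s r * W n r t))"
    using Suc.IH by (simp add: sum_distrib_left)
  also have "\<dots> = (\<Sum>r\<in>Q. \<Sum>s\<in>Q. A q s * (W m s r * W n r t))"
    by (rule sum.swap)
  finally show ?case
    by (simp add: sum_distrib_right mult.assoc)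
qed

lemma x_add: "q \<in> Q \<Longrightarrow> x (m + n) q = (\<Sum>r\<in>Q. W m q r * x n r)"
proof (induction m arbitrary: q)
  case 0
  then show ?case
    using finite_Q by (simp add: of_bool_def if_distrib[of "\<lambda>k. k * _"] cong: if_cong)
next
  case (Suc m)
  have "x (Suc m + n) q = (\<Sum>s\<in>Q. \<Sum>r\<in>Q. A q s * (W m s r * x n r))"
    using Suc.IH by (simp add: sum_distrib_left x_Suc)
  also have "\<dots> = (\<Sum>r\<in>Q. \<Sum>s\<in>Q. A q s * (W m s r * x n r))"
    by (rule sum.swap)
  finally show ?case
    by (simp add: sum_distrib_right mult.assoc)
qed

lemma W_mult_le: "q \<in> Q \<Longrightarrow> r \<in> Q \<Longrightarrow> W m q r * W n r t \<le> W (m + n) q t"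
  using finite_Q by (simp add: W_add member_le_sum[of r Q "\<lambda>r. W m q r * W n r t"])

lemma W_mult_x_le: "q \<in> Q \<Longrightarrow> r \<in> Q \<Longrightarrow> W m q r * x n r \<le> x (m + n) q"
  using finite_Q by (simp add: x_add member_le_sum[of r Q "\<lambda>r. W m q r * x n r"])

lemma W_add_pos: "q \<in> Q \<Longrightarrow> r \<in> Q \<Longrightarrow> W m q r > 0 \<Longrightarrow> W n r t > 0 \<Longrightarrow> W (m + n) q t > 0"
  using W_mult_le[of q r m n t] by (metis less_le_trans nat_0_less_mult_iff)

lemma W_mult_pos: "q \<in> Q \<Longrightarrow> W n q q > 0 \<Longrightarrow> W (n * k) q q > 0"
  by (induction k) (auto intro: W_add_pos)

text \<open>Each of the \<open>k\<close> rounds through \<open>q\<close> offers at least two closed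
  walks, and \<open>x j q > 0\<close> lets the walk finish.\<close>

lemma x_exponential: "q \<in> Q \<Longrightarrow> W l q q \<ge> 2 \<Longrightarrow> x j q > 0 \<Longrightarrow> 2 ^ k \<le> x (l * k + j) q"
proof (induction k)
  case (Suc k)
  then have "2 * 2 ^ k \<le> W l q q * x (l * k + j) q"
    by (intro mult_mono) auto
  also have "\<dots> \<le> x (l + (l * k + j)) q"
    using Suc.prems by (intro W_mult_x_le)
  finally show ?case
    by (simp add: add.assoc)
qed simp

text \<open>
  The period is a common multiple of the lengths of closed walks, one through each state that
  lies on a cycle, so every state on a cycle gets a positive diagonal entry in the matrix power.
\<close>

lemma obtain_period:
  obtains p where "p > 0" "\<And>q n k. q \<in> Q \<Longrightarrow> n > 0 \<Longrightarrow> W n q q > 0 \<Longrightarrow> W (p * k) q q > 0"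
proof -
  \<comment> \<open>A state on no cycle gets the default 1.\<close>
  have "\<exists>l>0. \<forall>n>0. W n q q > 0 \<longrightarrow> W l q q > 0" for q
    by (meson zero_less_one)
  then obtain l where l: "\<And>q. l q > 0" "\<And>q n. n > 0 \<Longrightarrow> W n q q > 0 \<Longrightarrow> W (l q) q q > 0"
    by metis
  show thesis
  proof (rule that[of "\<Prod>q\<in>Q. l q"])
    fix q n k assume q: "q \<in> Q" "n > 0" "W n q q > 0"
    obtain m where "(\<Prod>q\<in>Q. l q) = l q * m"
      using q(1) finite_Q by (metis dvdE dvd_prodI)
    then show "W ((\<Prod>q\<in>Q. l q) * k) q q > 0"
      using W_mult_pos[OF q(1) l(2)[OF q(2,3)], of "m * k"] by (simp add: mult.assoc)
  qed (simp add: l(1) prod_pos)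
qed

text \<open>Induction on the number of states reachable in multiples of \<open>p\<close> steps.
  Successors other than \<open>q\<close> cannot return to \<open>q\<close>, so they reach fewer
  states, and the diagonal entry at \<open>q\<close> is 0 or 1.\<close>

lemma eventually_poly_component:
  assumes p: "p > 0" "\<And>q n k. q \<in> Q \<Longrightarrow> n > 0 \<Longrightarrow> W n q q > 0 \<Longrightarrow> W (p * k) q q > 0"
    and R_step: "\<And>q r n. q \<in> R \<Longrightarrow> r \<in> Q \<Longrightarrow> W n q r > 0 \<Longrightarrow> r \<in> R"
    and unambiguous: "\<And>q n j. q \<in> R \<Longrightarrow> x j q > 0 \<Longrightarrow> W n q q \<le> 1"
    and R: "R \<subseteq> Q" "q \<in> R"
  shows "eventually_poly (\<lambda>k. x (p * k + s) q)"
  using R(2)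
proof (induction "card {r\<in>Q. \<exists>k. W (p * k) q r > 0}" arbitrary: q rule: less_induct)
  case less
  define reach where "reach q = {r\<in>Q. \<exists>k. W (p * k) q r > 0}" for q
  have q: "q \<in> Q"
    using less.prems R by blast
  show ?case
  proof (cases "\<exists>j. x j q > 0")
    case False
    then show ?thesis
      by (simp add: eventually_poly_const)
  next
    case True
    then have le_1: "W n q q \<le> 1" for n
      using unambiguous less.prems by blast
    have succ: "eventually_poly (\<lambda>k. x (p * k + s) r)" if r: "r \<in> Q - {q}" "W p q r > 0" for r
    proof -
      \<comment> \<open>A return from \<open>r\<close> would give two closed walks of length
        \<open>p + p * j\<close> at \<open>q\<close>: after \<open>p\<close> steps one is at
        \<open>q\<close>, the other at \<open>r\<close>.\<close>
      have "q \<notin> reach r"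
      proof
        assume "q \<in> reach r"
        then obtain j where j: "W (p * j) r q > 0"
          by (auto simp: reach_def)
        then have "W (p + p * j) q q > 0"
          using r q by (intro W_add_pos[of q r]) auto
        then have pos: "W (p * k) q q > 0" for k
          using p(2)[OF q, of "p + p * j"] p(1) by simp
        have "W p q q * W (p * j) q q > 0" "W p q r * W (p * j) r q > 0"
          using pos[of 1] pos[of j] r j by simp_all
        then have "2 \<le> W p q q * W (p * j) q q + W p q r * W (p * j) r q"
          by linarith
        also have "\<dots> = (\<Sum>t\<in>{q, r}. W p q t * W (p * j) t q)"
          using r by (subst sum.insert) auto
        also have "\<dots> \<le> W (p + p * j) q q"
          unfolding W_add[OF q] using r q finite_Q by (intro sum_mono2) auto
        finally show False
          using le_1[of "p + p * j"] by linarith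
      qed
      moreover have "q \<in> reach q"
        unfolding reach_def using q by (intro CollectI conjI exI[of _ 0]) simp_all
      moreover have "reach r \<subseteq> reach q"
      proof
        fix t assume "t \<in> reach r"
        then obtain k where "t \<in> Q" "W (p * k) r t > 0"
          by (auto simp: reach_def)
        then have "t \<in> Q" "W (p + p * k) q t > 0"
          using W_add_pos[of q r p "p * k" t] r q by auto
        then show "t \<in> reach q"
          unfolding reach_def by (intro CollectI conjI exI[of _ "Suc k"]) simp_all
      qed
      ultimately have "reach r \<subset> reach q"
        by (metis psubsetI)
      moreover have "finite (reach q)"
        using finite_Q by (simp add: reach_def)
      ultimately have "card (reach r) < card (reach q)"
        by (rule psubset_card_mono[rotated])
      then show ?thesis
        using less.hyps[of r] R_step[of q r p] less.prems r by (simp add: reach_def)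
    qed
    define g where "g k = (\<Sum>r\<in>Q - {q}. W p q r * x (p * k + s) r)" for k
    have g: "eventually_poly g"
      unfolding g_def
    proof (rule eventually_poly_sum)
      fix r assume "r \<in> Q - {q}"
      then show "eventually_poly (\<lambda>k. W p q r * x (p * k + s) r)"
        by (cases "W p q r = 0") (simp_all add: eventually_poly_const eventually_poly_cmult succ)
    qed
    have rec: "x (p * Suc k + s) q = W p q q * x (p * k + s) q + g k" for k
      using x_add[OF q, of p "p * k + s"] by (simp add: g_def sum.remove[OF finite_Q q] add.assoc)
    \<comment> \<open>In the first case the shifted sequence is \<open>g\<close>; in the second
      \<open>g\<close> is the sequence of differences.\<close>
    consider "W p q q = 0" | "W p q q = 1"
      using le_1[of p] by linarith
    then show ?thesis
    proof cases
      case 1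
      have "eventually_poly (\<lambda>k. x (p * Suc k + s) q)"
        unfolding rec 1 using g by simp
      then show ?thesis
        by (rule iffD1[OF eventually_poly_Suc_iff])
    next
      case 2
      show ?thesis
        by (rule eventually_poly_of_difference[OF _ g]) (simp only: rec 2 mult_1)
    qed
  qed
qed

lemma ultimately_PORC_of_subexponential:
  assumes \<phi>: "\<And>n. \<phi> n = (\<Sum>q\<in>Q. i q * x n q)"
    and growth: "\<And>a b. \<exists>k. \<phi> (a * k + b) < 2 ^ k"
  shows "ultimately_PORC \<phi>"
proof -
  obtain p where p: "p > 0" "\<And>q n k. q \<in> Q \<Longrightarrow> n > 0 \<Longrightarrow> W n q q > 0 \<Longrightarrow> W (p * k) q q > 0"
    by (rule obtain_period) (rule that)
  \<comment> \<open>The accessible states; only through them do the values \<open>x n q\<close>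
    bound \<open>\<phi>\<close> from below.\<close>
  define R where "R = {r\<in>Q. \<exists>q\<in>Q. \<exists>n. i q > 0 \<and> W n q r > 0}"
  have \<phi>_ge: "x n q \<le> \<phi> (m + n)" if "q0 \<in> Q" "i q0 > 0" "q \<in> Q" "W m q0 q > 0" for m n q0 q
  proof -
    have "1 * x n q \<le> W m q0 q * x n q"
      using that by (intro mult_right_mono) auto
    also have "\<dots> \<le> 1 * x (m + n) q0"
      using that by (simp add: W_mult_x_le)
    also have "\<dots> \<le> i q0 * x (m + n) q0"
      using that by (intro mult_right_mono) auto
    also have "\<dots> \<le> \<phi> (m + n)"
      unfolding \<phi> using that finite_Q by (intro member_le_sum) auto
    finally show ?thesis by simp
  qed
  have poly: "eventually_poly (\<lambda>k. x (p * k + s) q)" if "q \<in> R" for q s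
  proof (rule eventually_poly_component[OF p _ _ _ that])
    show "r \<in> R" if "q \<in> R" "r \<in> Q" "W n q r > 0" for q r n
      using that W_add_pos unfolding R_def by blast
  next
    fix q n j assume q: "q \<in> R" "x j q > 0"
    then obtain q0 m where q0: "q0 \<in> Q" "i q0 > 0" "q \<in> Q" "W m q0 q > 0"
      by (auto simp: R_def)
    show "W n q q \<le> 1"
    proof (rule ccontr)
      assume "\<not> W n q q \<le> 1"
      then have "2 ^ k \<le> \<phi> (n * k + (m + j))" for k
        using x_exponential[OF q0(3) _ q(2), of n k] \<phi>_ge[OF q0, of "n * k + j"]
        by (simp add: ac_simps)
      with growth[of n "m + j"] show False
        by (meson linorder_not_le)
    qed
  qed (auto simp: R_def)
  have "eventually_poly (\<lambda>k. \<phi> (p * k + s))" for s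
    unfolding \<phi>
  proof (rule eventually_poly_sum)
    fix q assume "q \<in> Q"
    then have "i q = 0 \<or> q \<in> R"
      by (auto simp: R_def intro!: bexI[of _ q] exI[of _ 0])
    then show "eventually_poly (\<lambda>k. i q * x (p * k + s) q)"
      by (auto simp: eventually_poly_const intro: eventually_poly_cmult poly)
  qed
  then obtain P :: "nat \<Rightarrow> rat poly" and N where
    P: "\<And>s k. k \<ge> N s \<Longrightarrow> of_nat (\<phi> (p * k + s)) = poly (P s) (of_nat k)"
    unfolding eventually_poly_def by metis
  \<comment> \<open>Large enough that \<open>n \<ge> N'\<close> forces
    \<open>n div p \<ge> N s\<close> for each residue \<open>s\<close>; the polynomial in
    \<open>n div p\<close> is then rewritten in \<open>n\<close>.\<close>
  define N' where "N' = (\<Sum>s<p. p * Suc (N s))"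
  have "of_nat (\<phi> n) = poly (pcompose (P (n mod p)) [:- of_nat (n mod p) / of_nat p, 1 / of_nat p:]) (of_nat n)"
    if "n \<ge> N'" for n
  proof -
    have "p * Suc (N (n mod p)) \<le> N'"
      unfolding N'_def using p by (intro member_le_sum) auto
    then have "N (n mod p) \<le> n div p"
      using that p(1) by (metis Suc_leD less_eq_div_iff_mult_less_eq mult.commute order.trans)
    moreover have "of_nat (n div p) = - of_nat (n mod p) / of_nat p + of_nat n * (1 / of_nat p :: rat)"
    proof -
      have "of_nat n = (of_nat p * of_nat (n div p) + of_nat (n mod p) :: rat)"
        by (simp flip: of_nat_mult of_nat_add)
      then show ?thesis
        using p(1) by (simp add: field_simps)
    qed
    ultimately show ?thesis
      using P[of "n mod p" "n div p"] by (simp add: poly_pcompose)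
  qed
  then show ?thesis
    unfolding ultimately_PORC_def
    using p(1) by (intro exI[of _ p] exI[of _ N']
        exI[of _ "\<lambda>s. pcompose (P s) [:- of_nat s / of_nat p, 1 / of_nat p:]"]) simp
qed

end

section \<open>Closure properties on unary words are ultimately PORC\<close>

lemma sharp_FA_exponential_bound:
  assumes "f \<in> sharp_FA \<Sigma>"
  obtains B C where "\<And>w. w \<in> lists \<Sigma> \<Longrightarrow> f w \<le> B * C ^ length w"
proof -
  obtain Q :: "nat set" and x A i where Q: "finite Q" "finite \<Sigma>"
    "\<And>a w q. x (a # w) q = (\<Sum>r\<in>Q. A q a r * x w r)"
    "\<And>w. w \<in> lists \<Sigma> \<Longrightarrow> f w = (\<Sum>q\<in>Q. i q * x w q)"
    by (rule sharp_FA_E[OF assms]) (rule that)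
  define B where "B = (\<Sum>q\<in>Q. x [] q)"
  \<comment> \<open>The sum of all transition weights bounds every row sum of every letter.\<close>
  define C where "C = (\<Sum>a\<in>\<Sigma>. \<Sum>q\<in>Q. \<Sum>r\<in>Q. A q a r)"
  have x: "q \<in> Q \<Longrightarrow> x w q \<le> B * C ^ length w" if "w \<in> lists \<Sigma>" for w q
    using that
  proof (induction w arbitrary: q rule: lists.induct)
    case Nil
    then show ?case
      unfolding B_def using Q(1) by (simp add: member_le_sum)
  next
    case (Cons a w)
    have "x (a # w) q \<le> (\<Sum>r\<in>Q. A q a r * (B * C ^ length w))"
      unfolding Q(3) using Cons by (intro sum_mono mult_left_mono) auto
    also have "\<dots> = (\<Sum>r\<in>Q. A q a r) * (B * C ^ length w)"
      by (simp add: sum_distrib_right)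
    also have "(\<Sum>r\<in>Q. A q a r) \<le> (\<Sum>q\<in>Q. \<Sum>r\<in>Q. A q a r)"
      using Cons.prems Q(1) by (intro member_le_sum[of q Q "\<lambda>q. \<Sum>r\<in>Q. A q a r"]) auto
    also have "\<dots> \<le> C"
      unfolding C_def using Cons.hyps Q(2)
      by (intro member_le_sum[of a \<Sigma> "\<lambda>a. \<Sum>q\<in>Q. \<Sum>r\<in>Q. A q a r"]) auto
    finally show ?case
      by (simp add: ac_simps)
  qed
  have "f w \<le> ((\<Sum>q\<in>Q. i q) * B) * C ^ length w" if "w \<in> lists \<Sigma>" for w
  proof -
    have "f w \<le> (\<Sum>q\<in>Q. i q * (B * C ^ length w))"
      unfolding Q(4)[OF that] using x[OF that] by (intro sum_mono mult_left_mono) auto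
    then show ?thesis
      by (simp add: mult.assoc flip: sum_distrib_right)
  qed
  then show thesis
    by (rule that)
qed

lemma double_exponential_unbounded:
  fixes B C :: nat
  shows "\<exists>k. B * C ^ k < 2 ^ 2 ^ k"
proof -
  \<comment> \<open>Chosen so that \<open>B + 2 * C * m\<close> is at most
    \<open>m * (m + 1)\<close>; the witness is \<open>k = 2 * m\<close>.\<close>
  define m where "m = B + 2 * C"
  have "B + C * (2 * m) \<le> m * (m + 1)"
    by (simp add: m_def algebra_simps)
  also have "\<dots> < (m + 1) * (m + 1)"
    by simp
  also have "\<dots> \<le> 2 ^ m * 2 ^ m"
    by (intro mult_mono) (simp_all add: Suc_le_eq)
  finally have m: "B + C * (2 * m) < 2 ^ (2 * m)"
    by (simp add: mult_2 power_add)
  have "B * C ^ (2 * m) \<le> 2 ^ B * (2 ^ C) ^ (2 * m)"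
    by (intro mult_mono power_mono) (simp_all add: less_imp_le[OF less_exp])
  also have "\<dots> = 2 ^ (B + C * (2 * m))"
    by (simp add: power_add power_mult)
  also have "\<dots> < 2 ^ 2 ^ (2 * m)"
    using m by simp
  finally show ?thesis ..
qed

text \<open>Composing \<open>\<phi>\<close> with the length yields a linear recurrence; composing it
  with \<open>c * 2 ^ n + d\<close> yields the growth bound.\<close>

lemma ultimately_PORC_of_unary_closure:
  fixes a :: 'a
  assumes closed: "\<And>f. f \<in> sharp_FA {a} \<Longrightarrow> (\<lambda>w. \<phi> (f w)) \<in> sharp_FA {a}"
  shows "ultimately_PORC \<phi>"
proof -
  have word: "replicate n a \<in> lists {a}" for n
    by (simp add: in_lists_conv_set)
  have "(\<lambda>w. \<phi> (length w)) \<in> sharp_FA {a}"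
    by (intro closed sharp_FA_length) simp
  then obtain Q :: "nat set" and x A i where Q: "finite Q" "finite {a}"
    "\<And>b w q. x (b # w) q = (\<Sum>r\<in>Q. A q b r * x w r)"
    "\<And>w. w \<in> lists {a} \<Longrightarrow> \<phi> (length w) = (\<Sum>q\<in>Q. i q * x w q)"
    by (rule sharp_FA_E) (rule that)
  interpret linear_recurrence Q "\<lambda>q. A q a" "\<lambda>n. x (replicate n a)"
    by unfold_locales (simp_all add: Q(1,3))
  show ?thesis
  proof (rule ultimately_PORC_of_subexponential)
    show "\<phi> n = (\<Sum>q\<in>Q. i q * x (replicate n a) q)" for n
      using Q(4)[OF word[of n]] by simp
  next
    fix c d
    have "(\<lambda>w. \<phi> (c * 2 ^ length w + d)) \<in> sharp_FA {a}"
      by (intro closed sharp_FA_add sharp_FA_mult sharp_FA_const sharp_FA_power_length) simp_all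
    then obtain B C where "\<And>w. w \<in> lists {a} \<Longrightarrow> \<phi> (c * 2 ^ length w + d) \<le> B * C ^ length w"
      by (rule sharp_FA_exponential_bound) (rule that)
    then have "\<phi> (c * 2 ^ k + d) \<le> B * C ^ k" for k
      using word[of k] by fastforce
    \<comment> \<open>The witness is a power of 2: there \<open>2 ^ k\<close> is doubly exponential
      in the word length.\<close>
    then show "\<exists>k. \<phi> (c * k + d) < 2 ^ k"
      using double_exponential_unbounded[of B C] by (meson le_less_trans)
  qed
qed

theorem theorem25:
  fixes \<phi> :: "nat \<Rightarrow> nat"
  shows "(functional_closure_property TYPE('a) \<phi> \<longleftrightarrow> ultimately_PORC \<phi>) \<and>
         (ultimately_PORC \<phi> \<longleftrightarrow>
            (\<forall>f\<in>sharp_FA {1 :: nat}. (\<lambda>w. \<phi> (f w)) \<in> sharp_FA {1 :: nat}))"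
proof -
  have "ultimately_PORC \<phi>" if "functional_closure_property TYPE('a) \<phi>"
    \<comment> \<open>Types are nonempty, so some letter exists and one-letter alphabets
      suffice.\<close>
    using that by (intro ultimately_PORC_of_unary_closure[of "undefined :: 'a"])
      (simp add: functional_closure_property_def)
  moreover have "functional_closure_property TYPE('a) \<phi>" if "ultimately_PORC \<phi>"
    using that by (simp add: functional_closure_property_def sharp_FA_ultimately_PORC)
  moreover have "ultimately_PORC \<phi>" if "\<forall>f\<in>sharp_FA {1 :: nat}. (\<lambda>w. \<phi> (f w)) \<in> sharp_FA {1 :: nat}"
    using that by (intro ultimately_PORC_of_unary_closure[of "1 :: nat"]) blast
  ultimately show ?thesis
    by (auto intro: sharp_FA_ultimately_PORC)
qed

end
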